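(* Let $q$ be a prime power, let $k\ge2$, and let $\widetilde{\mathcal{M}}$ be a two-character multiset in $\operatorname{PG}(k-1,q)$ with hyperplane multiplicities $s>t$. Let $\overline{\mathcal{M}}$ be the set of points with $\overline{\mathcal{M}}(H^\perp)=1$ if $\widetilde{\mathcal{M}}(H)=s$ and $\overline{\mathcal{M}}(H^\perp)=0$ if $\widetilde{\mathcal{M}}(H)=t$, for all $H\in\mathcal{H}$. Put $$\mathcal{M}:=\sum_{H\in\mathcal{H}}\overline{\mathcal{M}}(H^\perp)\cdot\chi_H,\quad \mu:=\min_{P\in\mathcal{P}}\mathcal{M}(P),\quad g:=\gcd\left(\{\mathcal{M}(P)-\mu:P\in\mathcal{P}\}\right),\quad \mathcal{M}':=\frac1g\left(\mathcal{M}-\mu\cdot\chi_V\right).$$ Then there exist unique $u,v\in\mathbb{N}$ such that $$\widetilde{\mathcal{M}}=u\cdot\mathcal{M}'+v\cdot\chi_V .$$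
   Context: $\mathbb{N}=\{0,1,2,\dots\}$. $\mathcal{P}$ and $\mathcal{H}$ denote the sets of points ($1$-dimensional subspaces of $\mathbb{F}_q^k$) and hyperplanes ($(k-1)$-dimensional subspaces of $\mathbb{F}_q^k$) of $\operatorname{PG}(k-1,q)$; for $k=2$ hyperplanes coincide with points. A multiset of points is a function $\mathcal{M}\colon\mathcal{P}\to\mathbb{N}$. For a set $S$ of points (a subspace being identified with the set of points it contains) put $\mathcal{M}(S)=\sum_{P\in S}\mathcal{M}(P)$; for a hyperplane $H$, $\mathcal{M}(H)$ is called the multiplicity of $H$. A set of points is a multiset of points with values in $\{0,1\}$. $\chi_S$ is the characteristic function of $S\subseteq\mathcal{P}$, and $\chi_V$ is the function with constant value $1$ on $\mathcal{P}$. Sums and scalar multiples of functions on $\mathcal{P}$ are pointwise. A two-character multiset is a multiset of points $\mathcal{M}$ such that $\{\mathcal{M}(H):H\in\mathcal{H}\}$ has exactly two elements. Fix a non-degenerate bilinear form on $\mathbb{F}_q^k$. For a point $P$ let $P^\perp$ be the hyperplane perpendicular to $P$; $P\mapsto P^\perp$ is a bijection $\mathcal{P}\to\mathcal{H}$, and for a hyperplane $H$ the point $P$ with $P^\perp=H$ is denoted $H^\perp$. *)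

theory Defs
  imports "HOL-Analysis.Cartesian_Space" "HOL-Library.Indicator_Function"
begin

text \<open>
  The ambient space \<open>\<bbbF>\<^sub>q\<^sup>k\<close> is the type \<open>'a ^ 'n\<close> with \<open>'a :: {field, finite}\<close>,
  so \<open>q = CARD('a)\<close> (automatically a prime power) and \<open>k = CARD('n)\<close>.
\<close>

definition pg_points :: "('a::{field,finite} ^ 'n) set set" where
  "pg_points = {P. vec.subspace P \<and> vec.dim P = 1}"

definition pg_hyperplanes :: "('a::{field,finite} ^ 'n) set set" where
  "pg_hyperplanes = {H. vec.subspace H \<and> vec.dim H = CARD('n) - 1}"

definition points_of :: "('a::{field,finite} ^ 'n) set \<Rightarrow> ('a ^ 'n) set set" where
  "points_of U = {P \<in> pg_points. P \<subseteq> U}"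

text \<open>
  A multiset of points is a function of type \<open>('a ^ 'n) set \<Rightarrow> nat\<close> of which only the values on
  \<^const>\<open>pg_points\<close> are ever used; two such functions represent the same multiset of points iff
  they agree on \<^const>\<open>pg_points\<close>.
\<close>

definition set_mult :: "(('a::{field,finite} ^ 'n) set \<Rightarrow> nat) \<Rightarrow> ('a ^ 'n) set set \<Rightarrow> nat" where
  "set_mult M S = (\<Sum>P\<in>S. M P)"

abbreviation subspace_mult :: "(('a::{field,finite} ^ 'n) set \<Rightarrow> nat) \<Rightarrow> ('a ^ 'n) set \<Rightarrow> nat" where
  "subspace_mult M U \<equiv> set_mult M (points_of U)"

definition is_point_set :: "(('a::{field,finite} ^ 'n) set \<Rightarrow> nat) \<Rightarrow> bool" where
  "is_point_set M \<longleftrightarrow> (\<forall>P\<in>pg_points. M P \<in> {0, 1})"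

definition two_character_multiset :: "(('a::{field,finite} ^ 'n) set \<Rightarrow> nat) \<Rightarrow> bool" where
  "two_character_multiset M \<longleftrightarrow> card (subspace_mult M ` pg_hyperplanes) = 2"

definition bilinear_form :: "('a::{field,finite} ^ 'n \<Rightarrow> 'a ^ 'n \<Rightarrow> 'a) \<Rightarrow> bool" where
  "bilinear_form B \<longleftrightarrow>
     (\<forall>x. Vector_Spaces.linear (*s) (*) (\<lambda>y. B x y)) \<and>
     (\<forall>y. Vector_Spaces.linear (*s) (*) (\<lambda>x. B x y))"

definition nondegenerate :: "('a::{field,finite} ^ 'n \<Rightarrow> 'a ^ 'n \<Rightarrow> 'a) \<Rightarrow> bool" where
  "nondegenerate B \<longleftrightarrow>
     (\<forall>x. (\<forall>y. B x y = 0) \<longrightarrow> x = 0) \<and> (\<forall>y. (\<forall>x. B x y = 0) \<longrightarrow> y = 0)"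

text \<open>
  The form need not be symmetric or even reflexive; \<open>P\<^sup>\<bottom>\<close> is then the right orthogonal space.
\<close>

definition perp :: "('a::{field,finite} ^ 'n \<Rightarrow> 'a ^ 'n \<Rightarrow> 'a) \<Rightarrow> ('a ^ 'n) set \<Rightarrow> ('a ^ 'n) set" where
  "perp B P = {y. \<forall>x\<in>P. B x y = 0}"

text \<open>
  \<open>H\<^sup>\<bottom>\<close> for a hyperplane \<open>H\<close> is the point \<open>P\<close> with \<open>P\<^sup>\<bottom> = H\<close>.  It is meaningful because
  \<open>P \<mapsto> P\<^sup>\<bottom>\<close> is a bijection from points to hyperplanes for bilinear, nondegenerate \<open>B\<close>.
\<close>

definition hyp_perp :: "('a::{field,finite} ^ 'n \<Rightarrow> 'a ^ 'n \<Rightarrow> 'a) \<Rightarrow> ('a ^ 'n) set \<Rightarrow> ('a ^ 'n) set" where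
  "hyp_perp B H = the_inv_into pg_points (perp B) H"

end

theory Submission imports Defs begin

text \<open>
  The multiset \<open>M\<close> counts, for each point, the hyperplanes of multiplicity \<open>s\<close> through it, and this
  number is an affine function of the multiplicity of the point in the given two-character multiset.
  Indeed, let \<open>r\<close> be the number of hyperplanes through a point and \<open>l < r\<close> the number of
  hyperplanes through two distinct points, and let \<open>n\<close> be the total multiplicity.  Summing the
  hyperplane multiplicities over all hyperplanes through \<open>P\<close> in two ways gives
  \<open>(r - l) * Mt P + l * n = t * r + (s - t) * M P\<close>,
  where the left-hand side groups by points (\<open>sum_hyperplanes_through\<close>) and the right-hand side by
  the two possible values (\<open>sum_two_valued\<close>).  That \<open>r\<close> and \<open>l\<close> do not depend on the points is
  clear by symmetry: the general linear group acts transitively on subspaces of a given dimension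
  (\<open>linear_automorphism_between_subspaces\<close>).

  Hence \<open>Mt\<close> and \<open>M\<close> attain their minima at the same points, and the differences from these minima
  are proportional families of natural numbers.  Two such families become equal when each is divided
  by its gcd (\<open>proportional_eq_mult_Gcd\<close>).  So \<open>v\<close> is the minimum of \<open>Mt\<close> and \<open>u\<close> the gcd of the
  differences of \<open>Mt\<close> from \<open>v\<close>.

  Finally \<open>M\<close> is not constant: otherwise \<open>Mt\<close> would be constant on points, and then all hyperplanes
  would have the same multiplicity.  Thus \<open>g > 0\<close>, and evaluating at a point where \<open>M\<close> is minimal
  and at one where it is not determines \<open>v\<close> and \<open>u\<close>.
\<close>

section \<open>Symmetry of the projective space\<close>

text \<open>
  The source of all counting constants below: a statistic of subspaces that is invariant under linear
  automorphisms depends on the dimension only.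
\<close>

lemma linear_automorphism_between_subspaces:
  fixes U W :: "('a::field ^ 'n) set"
  assumes "vec.subspace U" "vec.subspace W" "vec.dim U = vec.dim W"
  obtains f where "Vector_Spaces.linear (*s) (*s) f" "inj f" "f ` U = W"
proof -
  obtain C where C: "C \<subseteq> U" "vec.independent C" "U \<subseteq> vec.span C" "card C = vec.dim U"
    using vec.basis_exists by blast
  obtain D where D: "D \<subseteq> W" "vec.independent D" "W \<subseteq> vec.span D" "card D = vec.dim W"
    using vec.basis_exists by blast
  have "finite C" "finite D" using C(2) D(2) vec.finiteI_independent by auto
  then obtain h where h: "bij_betw h C D"
    using C(4) D(4) assms(3) finite_same_card_bij by metis
  then have "vec.independent (h ` C)" "inj_on h C"
    using D(2) by (simp_all add: bij_betw_def)
  then obtain f where f: "Vector_Spaces.linear (*s) (*s) f" "inj f" "\<forall>x\<in>C. f x = h x"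
    using vec.linear_independent_extend_inj[OF C(2)] by blast
  have "f ` U = f ` vec.span C"
    using vec.span_subspace[OF C(1,3) assms(1)] by simp
  also have "\<dots> = vec.span (f ` C)"
    using vec.linear_span_image[OF f(1)] by simp
  also have "f ` C = D"
    using f(3) h by (simp add: bij_betw_def)
  also have "vec.span D = W"
    using vec.span_subspace[OF D(1,3) assms(2)] .
  finally show ?thesis using that f by blast
qed

lemma dim_linear_image_inj:
  fixes f :: "'a::field ^ 'n \<Rightarrow> 'a ^ 'n"
  assumes "Vector_Spaces.linear (*s) (*s) f" "inj f"
  shows "vec.dim (f ` U) = vec.dim U"
  using vec.dim_image_eq[OF assms(1)] assms(2) inj_on_subset by blast

lemma finite_pg_points [simp]: "finite (pg_points :: ('a::{field,finite} ^ 'n) set set)"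
  and finite_pg_hyperplanes [simp]: "finite (pg_hyperplanes :: ('a ^ 'n) set set)"
  and finite_points_of [simp]: "finite (points_of (U :: ('a ^ 'n) set))"
  by (simp_all add: finite_subset[OF subset_UNIV])

definition hyperplanes_through :: "('a::{field,finite} ^ 'n) set \<Rightarrow> ('a ^ 'n) set set" where
  "hyperplanes_through U = {H \<in> pg_hyperplanes. U \<subseteq> H}"

lemma finite_hyperplanes_through [simp]: "finite (hyperplanes_through U)"
  by (simp add: hyperplanes_through_def)

lemma card_hyperplanes_through_le:
  fixes U W :: "('a::{field,finite} ^ 'n) set"
  assumes "vec.subspace U" "vec.subspace W" "vec.dim U = vec.dim W"
  shows "card (hyperplanes_through U) \<le> card (hyperplanes_through W)"
proof -
  obtain f where f: "Vector_Spaces.linear (*s) (*s) f" "inj f" "f ` U = W"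
    using linear_automorphism_between_subspaces[OF assms] .
  have "inj_on (image f) (hyperplanes_through U)"
    using f(2) by (simp add: inj_on_def inj_image_eq_iff)
  moreover have "image f ` hyperplanes_through U \<subseteq> hyperplanes_through W"
    using f by (auto simp: hyperplanes_through_def pg_hyperplanes_def dim_linear_image_inj
        vec.linear_subspace_image)
  ultimately show ?thesis by (rule card_inj_on_le) simp
qed

lemma card_hyperplanes_through_cong:
  fixes U W :: "('a::{field,finite} ^ 'n) set"
  assumes "vec.subspace U" "vec.subspace W" "vec.dim U = vec.dim W"
  shows "card (hyperplanes_through U) = card (hyperplanes_through W)"
  using card_hyperplanes_through_le assms by (metis le_antisym)

lemma card_points_of_le:
  fixes U W :: "('a::{field,finite} ^ 'n) set"
  assumes "vec.subspace U" "vec.subspace W" "vec.dim U = vec.dim W"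
  shows "card (points_of U) \<le> card (points_of W)"
proof -
  obtain f where f: "Vector_Spaces.linear (*s) (*s) f" "inj f" "f ` U = W"
    using linear_automorphism_between_subspaces[OF assms] .
  have "inj_on (image f) (points_of U)"
    using f(2) by (simp add: inj_on_def inj_image_eq_iff)
  moreover have "image f ` points_of U \<subseteq> points_of W"
    using f by (auto simp: points_of_def pg_points_def dim_linear_image_inj
        vec.linear_subspace_image)
  ultimately show ?thesis by (rule card_inj_on_le) simp
qed

lemma card_points_of_cong:
  fixes U W :: "('a::{field,finite} ^ 'n) set"
  assumes "vec.subspace U" "vec.subspace W" "vec.dim U = vec.dim W"
  shows "card (points_of U) = card (points_of W)"
  using card_points_of_le assms by (metis le_antisym)

section \<open>Hyperplanes through one and through two points\<close>

lemma pg_points_eq_span_singleton: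
  assumes "P \<in> pg_points"
  obtains x where "x \<noteq> 0" "P = vec.span {x}"
proof -
  have P: "vec.subspace P" "vec.dim P = 1" using assms by (simp_all add: pg_points_def)
  obtain C where C: "C \<subseteq> P" "vec.independent C" "P \<subseteq> vec.span C" "card C = vec.dim P"
    using vec.basis_exists by blast
  obtain x where x: "C = {x}" using C(4) P(2) by (metis card_1_singletonE)
  have "x \<noteq> 0" using C(2) x vec.dependent_zero by blast
  moreover have "P = vec.span {x}" using vec.span_subspace[OF C(1,3) P(1)] x by simp
  ultimately show ?thesis using that by blast
qed

lemma span_singleton_in_pg_points:
  "(x :: 'a::{field,finite} ^ 'n) \<noteq> 0 \<Longrightarrow> vec.span {x} \<in> pg_points"
  by (simp add: pg_points_def vec.dim_insert)

lemma distinct_points_independent: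
  assumes "P \<in> pg_points" "Q \<in> pg_points" "P \<noteq> Q"
  obtains x y where "P = vec.span {x}" "Q = vec.span {y}" "x \<noteq> y" "vec.independent {x, y}"
proof -
  obtain x where x: "x \<noteq> 0" "P = vec.span {x}"
    using pg_points_eq_span_singleton[OF assms(1)] .
  obtain y where y: "y \<noteq> 0" "Q = vec.span {y}"
    using pg_points_eq_span_singleton[OF assms(2)] .
  have "x \<notin> Q"
  proof
    assume "x \<in> Q"
    then have "P \<subseteq> Q" using x(2) y(2) by (simp add: vec.span_minimal)
    then have "P = Q"
      using vec.subspace_dim_equal[of P Q] assms(1,2) by (simp add: pg_points_def)
    then show False using assms(3) by simp
  qed
  then have "vec.independent {x, y}"
    using y by (simp add: vec.independent_insert)
  moreover have "x \<noteq> y" using \<open>x \<notin> Q\<close> y(2) vec.span_base by blast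
  ultimately show ?thesis using that x y by blast
qed

lemma dim_span_distinct_points:
  assumes "P \<in> pg_points" "Q \<in> pg_points" "P \<noteq> Q"
  shows "vec.dim (vec.span (P \<union> Q)) = 2"
proof -
  obtain x y where xy: "P = vec.span {x}" "Q = vec.span {y}" "x \<noteq> y" "vec.independent {x, y}"
    using distinct_points_independent[OF assms] .
  have "vec.span (P \<union> Q) = vec.span ({x} \<union> {y})"
    unfolding xy(1,2) vec.span_Un vec.span_span ..
  then have "vec.dim (vec.span (P \<union> Q)) = card {x, y}"
    using vec.dim_eq_card_independent[OF xy(4)] by (simp add: insert_commute)
  then show ?thesis using xy(3) by simp
qed

text \<open>
  Spanning vectors of the two points are part of a basis; dropping the second vector from it leaves
  a basis of the required hyperplane.
\<close>

lemma hyperplane_separating_points: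
  fixes P Q :: "('a::{field,finite} ^ 'n) set"
  assumes "P \<in> pg_points" "Q \<in> pg_points" "P \<noteq> Q"
  obtains H where "H \<in> pg_hyperplanes" "P \<subseteq> H" "\<not> Q \<subseteq> H"
proof -
  obtain x y where xy: "P = vec.span {x}" "Q = vec.span {y}" "x \<noteq> y" "vec.independent {x, y}"
    using distinct_points_independent[OF assms] .
  obtain C where C: "{x, y} \<subseteq> C" "vec.independent C" "UNIV \<subseteq> vec.span C"
    using vec.maximal_independent_subset_extend[OF subset_UNIV xy(4)] by metis
  have "card C = CARD('n)"
    using vec.basis_card_eq_dim[OF subset_UNIV C(3,2)] unfolding vec_dim_card .
  moreover have "vec.independent (C - {y})"
    using C(2) vec.independent_mono by blast
  ultimately have "vec.dim (vec.span (C - {y})) = CARD('n) - 1"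
    using C(1) by (simp add: vec.dim_eq_card_independent)
  then have "vec.span (C - {y}) \<in> pg_hyperplanes" by (simp add: pg_hyperplanes_def)
  moreover have "P \<subseteq> vec.span (C - {y})"
    unfolding xy(1) using C(1) xy(3) by (intro vec.span_mono) auto
  moreover have "y \<notin> vec.span (C - {y})"
    using C(1,2) by (auto simp: vec.dependent_def)
  then have "\<not> Q \<subseteq> vec.span (C - {y})"
    using xy(2) vec.span_base by blast
  ultimately show ?thesis using that by blast
qed

lemma distinct_points_exist:
  assumes "CARD('n) \<ge> 2"
  obtains P Q :: "('a::{field,finite} ^ 'n) set" where "P \<in> pg_points" "Q \<in> pg_points" "P \<noteq> Q"
proof -
  define x :: "'a ^ 'n" where "x = axis undefined 1"
  have x: "x \<noteq> 0" by (simp add: x_def)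
  then have P: "vec.span {x} \<in> pg_points" by (rule span_singleton_in_pg_points)
  have dim_ge: "vec.dim (UNIV :: ('a ^ 'n) set) \<ge> 2" using assms unfolding vec_dim_card .
  have "vec.span {x} \<noteq> UNIV"
  proof
    assume "vec.span {x} = UNIV"
    then have "(UNIV :: ('a ^ 'n) set) \<in> pg_points" using P by (simp only:)
    then have "vec.dim (UNIV :: ('a ^ 'n) set) = 1" unfolding pg_points_def by blast
    then show False using dim_ge by linarith
  qed
  then obtain y where y: "y \<notin> vec.span {x}" by blast
  then have "y \<noteq> 0" using vec.span_zero by metis
  then have "vec.span {y} \<in> pg_points" by (rule span_singleton_in_pg_points)
  moreover have "y \<in> vec.span {y}" by (simp add: vec.span_base)
  then have "vec.span {x} \<noteq> vec.span {y}" using y by metis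
  ultimately show ?thesis using that P by blast
qed

text \<open>
  The values are \<open>r = (q^(k-1) - 1) / (q - 1)\<close> and \<open>l = (q^(k-2) - 1) / (q - 1)\<close>, but only \<open>l < r\<close> matters,
  and that holds because some hyperplane separates two distinct points.
\<close>

lemma hyperplane_counts_constant:
  assumes "CARD('n) \<ge> 2"
  obtains l r where "l < r"
    "\<forall>P \<in> (pg_points :: ('a::{field,finite} ^ 'n) set set). card (hyperplanes_through P) = r"
    "\<forall>P \<in> (pg_points :: ('a ^ 'n) set set). \<forall>Q \<in> pg_points - {P}.
       card {H \<in> hyperplanes_through P. Q \<subseteq> H} = l"
proof -
  obtain P\<^sub>0 Q\<^sub>0 :: "('a ^ 'n) set"
    where 0: "P\<^sub>0 \<in> pg_points" "Q\<^sub>0 \<in> pg_points" "P\<^sub>0 \<noteq> Q\<^sub>0"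
    using distinct_points_exist[OF assms] .
  define r where "r = card (hyperplanes_through P\<^sub>0)"
  define l where "l = card (hyperplanes_through (vec.span (P\<^sub>0 \<union> Q\<^sub>0)))"
  have line: "hyperplanes_through (vec.span (P \<union> Q)) = {H \<in> hyperplanes_through P. Q \<subseteq> H}"
    for P Q :: "('a ^ 'n) set"
  proof -
    have "vec.span (P \<union> Q) \<subseteq> H \<longleftrightarrow> P \<subseteq> H \<and> Q \<subseteq> H" if "H \<in> pg_hyperplanes" for H
      using that vec.span_superset[of "P \<union> Q"] vec.span_minimal[of "P \<union> Q" H]
      by (auto simp: pg_hyperplanes_def)
    then show ?thesis by (auto simp: hyperplanes_through_def)
  qed
  have "hyperplanes_through (vec.span (P\<^sub>0 \<union> Q\<^sub>0)) \<subset> hyperplanes_through P\<^sub>0"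
    unfolding line using hyperplane_separating_points[OF 0]
    by (metis (mono_tags, lifting) hyperplanes_through_def mem_Collect_eq psubsetI subsetI)
  then have "l < r" unfolding l_def r_def by (intro psubset_card_mono) simp_all
  moreover have "card (hyperplanes_through P) = r" if "P \<in> pg_points" for P :: "('a ^ 'n) set"
    unfolding r_def using that 0(1)
    by (intro card_hyperplanes_through_cong) (simp_all add: pg_points_def)
  moreover have "card {H \<in> hyperplanes_through P. Q \<subseteq> H} = l"
    if "P \<in> pg_points" "Q \<in> pg_points" "P \<noteq> Q" for P Q :: "('a ^ 'n) set"
    unfolding l_def line[symmetric]
    by (intro card_hyperplanes_through_cong) (simp_all only: vec.subspace_span
        dim_span_distinct_points[OF that] dim_span_distinct_points[OF 0])
  ultimately show ?thesis using that by blast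
qed

section \<open>Double counting\<close>

text \<open>
  A point \<open>Q \<noteq> P\<close> is counted \<open>l\<close> times and \<open>P\<close> itself \<open>r\<close> times.  The summand \<open>l * m P\<close> is moved to
  the left so that the sum on the right runs over all points, making it independent of \<open>P\<close> without a
  subtraction of natural numbers.
\<close>

lemma sum_hyperplanes_through:
  fixes m :: "('a::{field,finite} ^ 'n) set \<Rightarrow> nat"
  assumes P: "P \<in> pg_points"
    and r: "card (hyperplanes_through P) = r"
    and l: "\<forall>Q \<in> pg_points - {P}. card {H \<in> hyperplanes_through P. Q \<subseteq> H} = l"
  shows "(\<Sum>H\<in>hyperplanes_through P. subspace_mult m H) + l * m P
           = r * m P + l * (\<Sum>Q\<in>pg_points. m Q)"
proof -
  have "(\<Sum>H\<in>hyperplanes_through P. subspace_mult m H)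
      = (\<Sum>H\<in>hyperplanes_through P. \<Sum>Q\<in>pg_points. if Q \<subseteq> H then m Q else 0)"
    by (simp add: set_mult_def points_of_def sum.inter_filter)
  also have "\<dots> = (\<Sum>Q\<in>pg_points. \<Sum>H\<in>hyperplanes_through P. if Q \<subseteq> H then m Q else 0)"
    by (rule sum.swap)
  also have "\<dots> = (\<Sum>Q\<in>pg_points. card {H \<in> hyperplanes_through P. Q \<subseteq> H} * m Q)"
    by (simp flip: sum.inter_filter)
  also have "\<dots> = r * m P + (\<Sum>Q\<in>pg_points - {P}. l * m Q)"
  proof -
    have "{H \<in> hyperplanes_through P. P \<subseteq> H} = hyperplanes_through P"
      by (auto simp: hyperplanes_through_def)
    then show ?thesis using P r l by (simp add: sum.remove[of pg_points P])
  qed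
  finally show ?thesis
    using P by (simp add: sum.remove[of pg_points P] sum_distrib_left algebra_simps)
qed

lemma sum_two_valued:
  fixes f :: "'b \<Rightarrow> nat"
  assumes "finite A" "f ` A \<subseteq> {s, t}" "t \<le> s"
  shows "sum f A = t * card A + (s - t) * card {x \<in> A. f x = s}"
proof -
  have "sum f A = (\<Sum>x\<in>A. t + (if f x = s then s - t else 0))"
    using assms by (intro sum.cong) auto
  also have "\<dots> = t * card A + (s - t) * card {x \<in> A. f x = s}"
    using assms(1) by (simp add: sum.distrib flip: sum.inter_filter)
  finally show ?thesis .
qed

text \<open>
  A multiset that is constant on points cannot have two hyperplane multiplicities, because all
  hyperplanes contain equally many points.
\<close>

lemma subspace_mult_hyperplanes_eq:
  fixes m :: "('a::{field,finite} ^ 'n) set \<Rightarrow> nat"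
  assumes "\<And>P. P \<in> pg_points \<Longrightarrow> m P = c" "H \<in> pg_hyperplanes" "K \<in> pg_hyperplanes"
  shows "subspace_mult m H = subspace_mult m K"
proof -
  have "subspace_mult m U = card (points_of U) * c" for U
    using assms(1) by (simp add: set_mult_def points_of_def)
  moreover have "card (points_of H) = card (points_of K)"
    using assms(2,3) by (intro card_points_of_cong) (simp_all add: pg_hyperplanes_def)
  ultimately show ?thesis by simp
qed

section \<open>Proportional families of natural numbers\<close>

text \<open>
  From \<open>a \<cdot> e = b \<cdot> d\<close> one gets \<open>a \<cdot> Gcd e = b \<cdot> Gcd d\<close>, and the factors \<open>a\<close> and \<open>b\<close> can be
  eliminated from these two equations.
\<close>

lemma proportional_eq_mult_Gcd:
  fixes d e :: "'b \<Rightarrow> nat"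
  assumes proportional: "\<And>x. x \<in> A \<Longrightarrow> a * e x = b * d x" and "a > 0" and x: "x \<in> A"
  shows "e x * Gcd (d ` A) = Gcd (e ` A) * d x"
proof -
  have "(*) a ` e ` A = (*) b ` d ` A"
    using proportional by (force simp: image_image)
  then have "a * Gcd (e ` A) = b * Gcd (d ` A)"
    by (metis Gcd_mult normalize_nat_def id_apply)
  then have "a * (e x * Gcd (d ` A)) = a * (Gcd (e ` A) * d x)"
    using proportional[OF x] by (metis mult.assoc mult.commute)
  then show ?thesis using \<open>a > 0\<close> by simp
qed

section \<open>Reconstruction of a two-character multiset\<close>

theorem theorem5p13:
  fixes B :: "'a::{field,finite} ^ 'n \<Rightarrow> 'a ^ 'n \<Rightarrow> 'a"
    and Mt Mbar M :: "('a ^ 'n) set \<Rightarrow> nat"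
    and M' :: "('a ^ 'n) set \<Rightarrow> rat"
    and s t \<mu> g :: nat
  assumes k: "CARD('n) \<ge> 2"
    and form: "bilinear_form B" "nondegenerate B"
    and two_char: "two_character_multiset Mt"
    and mults: "subspace_mult Mt ` pg_hyperplanes = {s, t}" "s > t"
    and Mbar_set: "is_point_set Mbar"
    and Mbar: "\<And>H. H \<in> pg_hyperplanes \<Longrightarrow> subspace_mult Mt H = s \<Longrightarrow> Mbar (hyp_perp B H) = 1"
              "\<And>H. H \<in> pg_hyperplanes \<Longrightarrow> subspace_mult Mt H = t \<Longrightarrow> Mbar (hyp_perp B H) = 0"
    and M: "M = (\<lambda>P. \<Sum>H\<in>pg_hyperplanes. Mbar (hyp_perp B H) * indicator (points_of H) P)"
    and \<mu>: "\<mu> = Min (M ` pg_points)"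
    and g: "g = Gcd {M P - \<mu> | P. P \<in> pg_points}"
    and M': "M' = (\<lambda>P. 1 / of_nat g * (of_nat (M P) - of_nat \<mu> * indicator pg_points P))"
  shows "\<exists>!uv :: nat \<times> nat. case uv of (u, v) \<Rightarrow>
           \<forall>P\<in>pg_points. of_nat (Mt P) = of_nat u * M' P + of_nat v * indicator pg_points P"
proof -
  obtain l r where "l < r"
    and r: "\<forall>P \<in> (pg_points :: ('a ^ 'n) set set). card (hyperplanes_through P) = r"
    and l: "\<forall>P \<in> (pg_points :: ('a ^ 'n) set set). \<forall>Q \<in> pg_points - {P}.
      card {H \<in> hyperplanes_through P. Q \<subseteq> H} = l"
    using hyperplane_counts_constant[OF k, where 'a = 'a] .
  define n where "n = (\<Sum>Q\<in>pg_points. Mt Q)"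
  have pts: "pg_points \<noteq> ({} :: ('a ^ 'n) set set)"
    using distinct_points_exist[OF k, where 'a = 'a] by blast

  \<comment> \<open>The point \<open>hyp_perp B H\<close> acts as a label of \<open>H\<close>, marking the hyperplanes of multiplicity \<open>s\<close>.\<close>
  have M_eq: "M P = card {H \<in> hyperplanes_through P. subspace_mult Mt H = s}"
    if P: "P \<in> pg_points" for P
  proof -
    have "M P = (\<Sum>H\<in>pg_hyperplanes. if P \<subseteq> H \<and> subspace_mult Mt H = s then 1 else 0)"
      unfolding M
    proof (intro sum.cong refl)
      fix H :: "('a ^ 'n) set" assume H: "H \<in> pg_hyperplanes"
      then have "subspace_mult Mt H = s \<or> subspace_mult Mt H = t" using mults(1) by blast
      then show "Mbar (hyp_perp B H) * indicator (points_of H) P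
          = (if P \<subseteq> H \<and> subspace_mult Mt H = s then 1 else 0)"
        using Mbar[OF H] mults(2) P by (auto simp: points_of_def indicator_def)
    qed
    also have "\<dots> = card {H \<in> pg_hyperplanes. P \<subseteq> H \<and> subspace_mult Mt H = s}"
      by (simp flip: sum.inter_filter)
    also have "{H \<in> pg_hyperplanes. P \<subseteq> H \<and> subspace_mult Mt H = s}
        = {H \<in> hyperplanes_through P. subspace_mult Mt H = s}"
      by (auto simp: hyperplanes_through_def)
    finally show ?thesis .
  qed

  have affine: "r * Mt P + l * n = t * r + (s - t) * M P + l * Mt P"
    if P: "P \<in> pg_points" for P
  proof -
    have "subspace_mult Mt ` hyperplanes_through P \<subseteq> {s, t}"
      using mults(1) by (auto simp: hyperplanes_through_def)
    then have "(\<Sum>H\<in>hyperplanes_through P. subspace_mult Mt H) = t * r + (s - t) * M P"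
      using sum_two_valued[OF finite_hyperplanes_through, of "subspace_mult Mt" P s t] mults(2)
      by (simp add: bspec[OF r P] M_eq[OF P])
    then show ?thesis
      using sum_hyperplanes_through[OF P bspec[OF r P] bspec[OF l P], of Mt] by (simp add: n_def)
  qed

  have "\<mu> \<in> M ` pg_points" unfolding \<mu> using pts by (intro Min_in) simp_all
  then obtain P\<^sub>0 where P\<^sub>0: "P\<^sub>0 \<in> pg_points" "M P\<^sub>0 = \<mu>" by blast
  have \<mu>_le: "\<mu> \<le> M P" if "P \<in> pg_points" for P
    unfolding \<mu> using that by simp

  \<comment> \<open>Subtracting the affine relation at a minimum point; over the integers, to justify the
    truncated differences afterwards.\<close>
  have int_prop: "int (r - l) * (int (Mt P) - int (Mt P\<^sub>0)) = int (s - t) * (int (M P) - int \<mu>)"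
    if P: "P \<in> pg_points" for P
  proof -
    have "int r * int (Mt P) + int l * int n = int t * int r + int (s - t) * int (M P) + int l * int (Mt P)"
      using arg_cong[OF affine[OF P], of int] by simp
    moreover have "int r * int (Mt P\<^sub>0) + int l * int n = int t * int r + int (s - t) * int \<mu> + int l * int (Mt P\<^sub>0)"
      using arg_cong[OF affine[OF P\<^sub>0(1)], of int] P\<^sub>0(2) by simp
    ultimately show ?thesis
      using \<open>l < r\<close> by (simp add: of_nat_diff[of l r] algebra_simps del: of_nat_diff)
  qed
  have v_le: "Mt P\<^sub>0 \<le> Mt P" if P: "P \<in> pg_points" for P
  proof -
    have "0 \<le> int (r - l) * (int (Mt P) - int (Mt P\<^sub>0))"
      unfolding int_prop[OF P] using \<mu>_le[OF P] by (intro mult_nonneg_nonneg) simp_all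
    then show ?thesis using \<open>l < r\<close> by (simp add: zero_le_mult_iff)
  qed
  have proportional: "(r - l) * (Mt P - Mt P\<^sub>0) = (s - t) * (M P - \<mu>)" if P: "P \<in> pg_points" for P
  proof -
    have "int ((r - l) * (Mt P - Mt P\<^sub>0)) = int ((s - t) * (M P - \<mu>))"
      using int_prop[OF P] v_le[OF P] \<mu>_le[OF P] by (simp only: of_nat_mult of_nat_diff)
    then show ?thesis by (simp only: of_nat_eq_iff)
  qed

  have "\<exists>P\<in>pg_points. M P \<noteq> \<mu>"
  proof (rule ccontr)
    assume "\<not> ?thesis"
    then have "Mt P = Mt P\<^sub>0" if "P \<in> pg_points" for P
      using that proportional[OF that] v_le[OF that] \<open>l < r\<close> by simp
    then have eq: "subspace_mult Mt H = subspace_mult Mt K"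
      if "H \<in> pg_hyperplanes" "K \<in> pg_hyperplanes" for H K
      using that by (rule subspace_mult_hyperplanes_eq)
    have "s \<in> subspace_mult Mt ` pg_hyperplanes" "t \<in> subspace_mult Mt ` pg_hyperplanes"
      unfolding mults(1) by simp_all
    then obtain H K where "H \<in> pg_hyperplanes" "s = subspace_mult Mt H"
      "K \<in> pg_hyperplanes" "t = subspace_mult Mt K"
      by (elim imageE)
    then show False using eq[of H K] mults(2) by simp
  qed
  then obtain P\<^sub>1 where P\<^sub>1: "P\<^sub>1 \<in> pg_points" "M P\<^sub>1 \<noteq> \<mu>" by blast

  have g_image: "g = Gcd ((\<lambda>P. M P - \<mu>) ` pg_points)"
    unfolding g by (rule arg_cong[of _ _ Gcd]) auto
  have "g dvd M P\<^sub>1 - \<mu>"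
    unfolding g_image using P\<^sub>1(1) by (intro Gcd_dvd imageI)
  then have "g \<noteq> 0"
    using P\<^sub>1(2) \<mu>_le[OF P\<^sub>1(1)] by (intro notI) simp
  have M'_eq: "M' P = of_nat (M P - \<mu>) / of_nat g" if "P \<in> pg_points" for P
    using that \<mu>_le by (simp add: M' of_nat_diff)

  define u where "u = Gcd ((\<lambda>P. Mt P - Mt P\<^sub>0) ` pg_points)"
  show ?thesis
  proof (rule ex1I[of _ "(u, Mt P\<^sub>0)"])
    have "of_nat (Mt P) = of_nat u * M' P + of_nat (Mt P\<^sub>0) * indicator pg_points P"
      if P: "P \<in> pg_points" for P
    proof -
      have "(Mt P - Mt P\<^sub>0) * g = u * (M P - \<mu>)"
        unfolding g_image u_def using \<open>l < r\<close>
        by (intro proportional_eq_mult_Gcd[of pg_points "r - l" _ "s - t"] proportional P) simp_all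
      then have "(of_nat (Mt P - Mt P\<^sub>0) :: rat) * of_nat g = of_nat u * of_nat (M P - \<mu>)"
        by (metis of_nat_mult)
      then have "of_nat u * M' P = of_nat (Mt P - Mt P\<^sub>0)"
        using \<open>g \<noteq> 0\<close> by (simp add: M'_eq[OF P] field_simps)
      then show ?thesis using P v_le[OF P] by (simp add: of_nat_diff)
    qed
    then show "case (u, Mt P\<^sub>0) of (u, v) \<Rightarrow>
      \<forall>P\<in>pg_points. of_nat (Mt P) = of_nat u * M' P + of_nat v * indicator pg_points P"
      by simp
    then have at_P\<^sub>1: "of_nat (Mt P\<^sub>1) = of_nat u * M' P\<^sub>1 + of_nat (Mt P\<^sub>0)"
      using P\<^sub>1(1) by simp
    fix uv :: "nat \<times> nat"
    assume uv: "case uv of (u, v) \<Rightarrow>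
      \<forall>P\<in>pg_points. of_nat (Mt P) = of_nat u * M' P + of_nat v * indicator pg_points P"
    obtain u' v' where uv': "uv = (u', v')" by (cases uv)
    have "M' P\<^sub>0 = 0" using P\<^sub>0 by (simp add: M'_eq)
    then have "(of_nat (Mt P\<^sub>0) :: rat) = of_nat v'" using uv P\<^sub>0(1) by (simp add: uv')
    then have v': "v' = Mt P\<^sub>0" by simp
    have "M' P\<^sub>1 \<noteq> 0"
      using P\<^sub>1 \<mu>_le[OF P\<^sub>1(1)] \<open>g \<noteq> 0\<close> by (simp add: M'_eq)
    moreover have "of_nat u' * M' P\<^sub>1 = of_nat u * M' P\<^sub>1"
      using uv P\<^sub>1(1) at_P\<^sub>1 by (simp add: uv' v')
    ultimately have "u' = u" by simp
    then show "uv = (u, Mt P\<^sub>0)" by (simp add: uv' v')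
  qed
qed

end
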